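(* Let ${\rm K}_{n,\infty}$ be the sharp (smallest possible) constant in the inequality $|f^{(n)}(z)|\le \frac{{\rm K}_{n,\infty}}{(\Im z)^{n}}\|\Re f\|_\infty$, valid for all analytic functions $f$ in $\mathbb{C}_+$ with $\Re f\in h^\infty(\mathbb{R}^2_+)$ and all points $z\in\mathbb{C}_+$. Then $${\rm K}_{2m,\infty}=\frac{2}{\pi}\big((2m-1)!!\big)^2+O\!\left(\frac{\big((2m-1)!!\big)^2}{2m-1}\right)\quad\text{as } m\to\infty .$$
   Context: $\mathbb{C}_+=\{z\in\mathbb{C}:\Im z>0\}$, identified with $\mathbb{R}^2_+$. $h^\infty(\mathbb{R}^2_+)$ is the space of harmonic functions in the upper half-plane of the form $u(x+iy)=\frac{1}{\pi}\int_{-\infty}^{\infty}\frac{y\,g(t)}{(x-t)^2+y^2}\,dt$ with real $g\in L^\infty(-\infty,\infty)$; $\|\Re f\|_\infty$ denotes the $L^\infty(-\infty,\infty)$ norm of the boundary values $g$ of $\Re f$ on $\mathbb{R}$. A previously known representation (Kresin and Maz'ya) is $${\rm K}_{2m,\infty}=\frac{(2m)!}{\pi}\max_{\alpha\in\mathbb{R}}\int_{-\pi/2}^{\pi/2}\big|\cos(\alpha-(2m+1)\varphi)\big|\cos^{2m-1}\varphi\,d\varphi .$$ $k!!$ denotes the double factorial. *)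

theory Defs
  imports
    "HOL-Complex_Analysis.Complex_Analysis"
    "HOL-Probability.Essential_Supremum"
    "HOL-Library.Landau_Symbols"
begin

definition upper_half_plane :: "complex set" where
  "upper_half_plane = {z. Im z > 0}"

(* The type ereal is needed because esssup takes values in a complete linear order. *)
definition Linf_norm :: "(real \<Rightarrow> real) \<Rightarrow> ereal" where
  "Linf_norm g = esssup lebesgue (\<lambda>t. ereal \<bar>g t\<bar>)"

(* Measurability of g is required separately: the finiteness of esssup only yields
   measurability of the absolute value. *)
definition Linf :: "(real \<Rightarrow> real) set" where
  "Linf = {g \<in> borel_measurable lebesgue. Linf_norm g < \<infinity>}"

definition poisson_integral :: "(real \<Rightarrow> real) \<Rightarrow> complex \<Rightarrow> real" where
  "poisson_integral g z =
     (1 / pi) * (LINT t|lebesgue. Im z * g t / ((Re z - t)\<^sup>2 + (Im z)\<^sup>2))"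

(* u belongs to the space h^infinity of the upper half-plane iff some g satisfies
   hinf_with_boundary u g. Such a g is unique up to null sets, so Linf_norm g depends on u only. *)
definition hinf_with_boundary :: "(complex \<Rightarrow> real) \<Rightarrow> (real \<Rightarrow> real) \<Rightarrow> bool" where
  "hinf_with_boundary u g \<longleftrightarrow>
     g \<in> Linf \<and> (\<forall>z\<in>upper_half_plane. u z = poisson_integral g z)"

definition valid_const :: "nat \<Rightarrow> real \<Rightarrow> bool" where
  "valid_const n K \<longleftrightarrow>
     (\<forall>f g z. f analytic_on upper_half_plane \<longrightarrow> hinf_with_boundary (\<lambda>w. Re (f w)) g \<longrightarrow>
        z \<in> upper_half_plane \<longrightarrow>
        cmod ((deriv ^^ n) f z) \<le> K / Im z ^ n * real_of_ereal (Linf_norm g))"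

definition sharp_const :: "nat \<Rightarrow> real" where
  "sharp_const n = (LEAST K. valid_const n K)"

fun double_fact :: "nat \<Rightarrow> nat" where
  "double_fact 0 = 1"
| "double_fact (Suc 0) = 1"
| "double_fact (Suc (Suc n)) = Suc (Suc n) * double_fact n"

end

theory Submission
  imports
    Defs
    "HOL-Probability.Sinc_Integral"
    "HOL-Library.Periodic_Fun"
    "HOL-Real_Asymp.Real_Asymp"
begin

text \<open>
  If \<open>Re f\<close> is the Poisson integral of \<open>g\<close>, then for \<open>n > 0\<close> the \<open>n\<close>-th derivative of \<open>f\<close> at \<open>z\<close> is
  \<open>n! / (\<pi> i)\<close> times the integral of \<open>g(t) / (t - z)^(n + 1)\<close>. Rotating the value onto the real axis
  and substituting \<open>t = Re z + Im z * tan \<phi>\<close> shows that the sharp constant lies between any lower and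
  upper bound for \<open>n! / \<pi>\<close> times the integral of
  \<open>\<bar>cos (\<beta> - (n + 1) \<phi>)\<bar> * cos \<phi> ^ (n - 1)\<close> over \<open>\<bar>\<phi>\<bar> \<le> \<pi> / 2\<close>, uniformly in \<open>\<beta>\<close>.
  The first factor oscillates much faster than the second one varies, so it may be replaced by its mean
  \<open>2 / \<pi>\<close>: two integrations by parts bound the relative error by \<open>O(1 / n)\<close>. The remaining integral of
  \<open>cos \<phi> ^ (2m - 1)\<close> is a quotient of double factorials, and the monotonicity of the Wallis products
  compares it with \<open>((2m - 1)!!)\<^sup>2\<close>.
\<close>

subsection \<open>Cauchy transforms of bounded functions\<close>

text \<open>An affine substitution reduces this to 1 / (1 + t^2). The function serves as the common
  majorant: each kernel below is dominated by a constant multiple of it, or of the sum of two such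
  functions.\<close>

lemma integrable_inverse_dist_square:
  assumes "Im z > 0"
  shows "integrable lebesgue (\<lambda>t. 1 / (cmod (of_real t - z))\<^sup>2)"
proof -
  have *: "integrable lborel (\<lambda>t::real. inverse (1 + t\<^sup>2))"
    using integrable_inverse_1_plus_square
    by (simp add: set_integrable_def einterval_def)
  have "integrable lborel (\<lambda>t. inverse (1 + (- Re z / Im z + (1 / Im z) * t)\<^sup>2))"
    by (rule lborel_integrable_real_affine[OF *]) (use assms in auto)
  then have "integrable lborel (\<lambda>t. (1 / (Im z)\<^sup>2) * inverse (1 + (- Re z / Im z + (1 / Im z) * t)\<^sup>2))"
    by (rule integrable_mult_right)
  moreover have "(1 / (Im z)\<^sup>2) * inverse (1 + (- Re z / Im z + (1 / Im z) * t)\<^sup>2) = 1 / (cmod (of_real t - z))\<^sup>2" for t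
  proof -
    have "- Re z / Im z + (1 / Im z) * t = (t - Re z) / Im z" by (simp add: diff_divide_distrib)
    moreover have "(Im z)\<^sup>2 * (1 + ((t - Re z) / Im z)\<^sup>2) = (cmod (of_real t - z))\<^sup>2"
      using assms by (simp add: cmod_power2 power_divide field_simps)
    ultimately show ?thesis
      by (metis inverse_eq_divide inverse_mult_distrib)
  qed
  ultimately have "integrable lborel (\<lambda>t. 1 / (cmod (of_real t - z))\<^sup>2)" by simp
  then show ?thesis
    by (simp add: integrable_completion borel_measurable_integrable)
qed

lemma Im_le_cmod_of_real_diff: "Im z \<le> cmod (of_real t - z)"
  using abs_Im_le_cmod[of "of_real t - z"] by simp

text \<open>A real number as bound, together with measurability, keeps the extended-real
  \<open>esssup\<close> out of the integral estimates; \<open>Linf_essbound\<close> makes the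
  link.\<close>

definition essbound :: "(real \<Rightarrow> real) \<Rightarrow> real \<Rightarrow> bool" where
  "essbound g M \<longleftrightarrow> g \<in> borel_measurable lebesgue \<and> (AE t in lebesgue. \<bar>g t\<bar> \<le> M)"

lemma AE_lebesgue_imp_ex:
  assumes "AE t::real in lebesgue. P t"
  shows "\<exists>t. P t"
proof (rule ccontr)
  assume "\<not> ?thesis"
  then have "AE t::real in lebesgue. False" using assms by auto
  then have "emeasure lebesgue (UNIV::real set) = 0"
    using AE_iff_measurable[of UNIV lebesgue "\<lambda>_::real. False"] by auto
  then show False by simp
qed

lemma essbound_nonneg:
  assumes "essbound g M" shows "0 \<le> M"
proof -
  obtain t where "\<bar>g t\<bar> \<le> M" using AE_lebesgue_imp_ex assms unfolding essbound_def by blast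
  then show ?thesis by (rule order_trans[OF abs_ge_zero])
qed

lemma measurable_ident_lebesgue [measurable]: "(\<lambda>t::real. t) \<in> borel_measurable lebesgue"
  by (intro borel_measurable_continuous_onI measurable_completion) (auto intro!: continuous_intros)

lemma essbound_integrable:
  fixes h :: "real \<Rightarrow> complex"
  assumes g: "essbound g M" and h: "h \<in> borel_measurable lebesgue"
    and k: "integrable lebesgue k" and hk: "\<And>t. cmod (h t) \<le> k t"
  shows "integrable lebesgue (\<lambda>t. of_real (g t) * h t)"
    and "LINT t|lebesgue. norm (of_real (g t) * h t) \<le> M * (LINT t|lebesgue. k t)"
proof -
  have gm [measurable]: "g \<in> borel_measurable lebesgue" and M: "AE t in lebesgue. \<bar>g t\<bar> \<le> M"
    using g by (auto simp: essbound_def)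
  note h [measurable]
  have M0: "0 \<le> M" using essbound_nonneg g .
  have k0: "0 \<le> k t" for t using hk[of t] norm_ge_zero order_trans by blast
  have B: "AE t in lebesgue. norm (of_real (g t) * h t) \<le> norm (M * k t)"
    using M by eventually_elim (use hk M0 k0 in \<open>auto simp: norm_mult intro!: mult_mono\<close>)
  show I: "integrable lebesgue (\<lambda>t. of_real (g t) * h t)"
    by (rule Bochner_Integration.integrable_bound[OF integrable_mult_right[OF k, of M] _ B]) measurable
  have "LINT t|lebesgue. norm (of_real (g t) * h t) \<le> (LINT t|lebesgue. M * k t)"
    by (rule integral_mono_AE[OF integrable_norm[OF I] integrable_mult_right[OF k]])
      (use B M0 k0 in auto)
  then show "LINT t|lebesgue. norm (of_real (g t) * h t) \<le> M * (LINT t|lebesgue. k t)" by simp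
qed

text \<open>Since |t - z| >= Im z for real t, each power beyond the second costs at most a factor 1
  / Im z. This geometric growth in \<open>k\<close> is what later gives power series convergent in
  the disc of radius Im z.\<close>

lemma essbound_kernel_power:
  assumes g: "essbound g M" and z: "Im z > 0"
  shows "integrable lebesgue (\<lambda>t. of_real (g t) * (1 / (of_real t - z) ^ (k + 2)))"
    and "LINT t|lebesgue. norm (of_real (g t) * (1 / (of_real t - z) ^ (k + 2)))
         \<le> M * (LINT t|lebesgue. 1 / (cmod (of_real t - z))\<^sup>2) / Im z ^ k"
proof -
  have *: "cmod (1 / (of_real t - z) ^ (k + 2)) \<le> (1 / Im z ^ k) * (1 / (cmod (of_real t - z))\<^sup>2)" for t
  proof -
    have "Im z ^ k \<le> cmod (of_real t - z) ^ k"
      using Im_le_cmod_of_real_diff[of z t] z by (intro power_mono) auto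
    moreover have "cmod (of_real t - z) > 0" using Im_le_cmod_of_real_diff[of z t] z by linarith
    ultimately show ?thesis
      using z by (simp add: norm_divide norm_power norm_mult power_add frac_le power2_eq_square mult.commute)
  qed
  note k = integrable_mult_right[OF integrable_inverse_dist_square[OF z], of "1 / Im z ^ k"]
  have m: "(\<lambda>t. 1 / (of_real t - z) ^ (k + 2)) \<in> borel_measurable lebesgue" by measurable
  show "integrable lebesgue (\<lambda>t. of_real (g t) * (1 / (of_real t - z) ^ (k + 2)))"
    by (rule essbound_integrable(1)[OF g m k *])
  show "LINT t|lebesgue. norm (of_real (g t) * (1 / (of_real t - z) ^ (k + 2)))
         \<le> M * (LINT t|lebesgue. 1 / (cmod (of_real t - z))\<^sup>2) / Im z ^ k"
    using essbound_integrable(2)[OF g m k *] unfolding integral_mult_right_zero by simp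
qed

lemma essbound_kernel_product:
  assumes g: "essbound g M" and z: "Im z > 0" and w: "Im w > 0"
  shows "integrable lebesgue (\<lambda>t. of_real (g t) * (c / ((of_real t - w) * (of_real t - z))))"
proof -
  have *: "cmod (c / ((of_real t - w) * (of_real t - z)))
     \<le> cmod c * (1 / (cmod (of_real t - w))\<^sup>2 + 1 / (cmod (of_real t - z))\<^sup>2)" for t
  proof -
    define a b where "a = 1 / cmod (of_real t - w)" and "b = 1 / cmod (of_real t - z)"
    have "a * b \<le> a\<^sup>2 + b\<^sup>2"
    proof -
      have "0 \<le> a * b" by (simp add: a_def b_def)
      then show ?thesis using sum_squares_bound[of a b] by linarith
    qed
    then have "cmod c * (a * b) \<le> cmod c * (a\<^sup>2 + b\<^sup>2)" by (intro mult_left_mono) auto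
    then show ?thesis by (simp add: a_def b_def norm_divide norm_mult power_divide)
  qed
  show ?thesis
    by (rule essbound_integrable(1)[OF g _ integrable_mult_right[OF Bochner_Integration.integrable_add[OF
            integrable_inverse_dist_square[OF w] integrable_inverse_dist_square[OF z]]] *])
      measurable
qed

text \<open>The kernel equals 1 / (t - w) - 1 / (t - z). The subtraction at the base point
  \<open>z\<close> makes it decay like t^(-2), so the integral converges even if \<open>g\<close> is
  merely bounded.\<close>

definition cauchy_transform :: "(real \<Rightarrow> real) \<Rightarrow> complex \<Rightarrow> complex \<Rightarrow> complex" where
  "cauchy_transform g z w =
     (LINT t|lebesgue. of_real (g t) * ((w - z) / ((of_real t - w) * (of_real t - z))))"

definition cauchy_coeff :: "(real \<Rightarrow> real) \<Rightarrow> complex \<Rightarrow> nat \<Rightarrow> complex" where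
  "cauchy_coeff g z n = (LINT t|lebesgue. of_real (g t) * (1 / (of_real t - z) ^ (n + 1)))"

lemma of_real_neq_upper: "Im z > 0 \<Longrightarrow> of_real t \<noteq> z"
  by auto

text \<open>Moving the base point from \<open>z\<close> to \<open>v\<close> changes the transform by
  a constant in \<open>w\<close>. Local statements on discs thereby spread to the whole
  half-plane.\<close>

lemma cauchy_transform_split:
  assumes g: "essbound g M" and "Im z > 0" "Im v > 0" "Im w > 0"
  shows "cauchy_transform g z w = cauchy_transform g z v + cauchy_transform g v w"
proof -
  have "(v - z) / ((of_real t - v) * (of_real t - z)) + (w - v) / ((of_real t - w) * (of_real t - v))
      = (w - z) / ((of_real t - w) * (of_real t - z))" for t
    using assms by (simp add: of_real_neq_upper divide_simps) (simp add: algebra_simps)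
  then show ?thesis
    unfolding cauchy_transform_def
    by (subst Bochner_Integration.integral_add[symmetric])
      (use assms essbound_kernel_product in \<open>simp_all only: flip: distrib_left\<close>)
qed

text \<open>The factor 1 / (t - w) is a geometric series in (w - z) / (t - z), of modulus below 1
  for every real t. The constant term is set to 0 because the transform vanishes at its base point,
  whereas the integrand of \<open>cauchy_coeff g z 0\<close> decays only like 1 / t and may fail to
  be integrable.\<close>

lemma cauchy_transform_sums:
  assumes g: "essbound g M" and w: "cmod (w - z) < Im z"
  shows "(\<lambda>k. (if k = 0 then 0 else cauchy_coeff g z k) * (w - z) ^ k) sums cauchy_transform g z w"
proof -
  have z: "Im z > 0" using w norm_ge_zero[of "w - z"] by linarith
  define q where "q = cmod (w - z) / Im z"
  have q: "0 \<le> q" "q < 1" using w z by (auto simp: q_def)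
  define f where "f k t = of_real (g t) * (1 / (of_real t - z) ^ (k + 2)) * (w - z) ^ (k + 1)" for k t
  define C where "C = M * (LINT t|lebesgue. 1 / (cmod (of_real t - z))\<^sup>2)"
  have fI: "integrable lebesgue (f k)" for k
    unfolding f_def by (intro integrable_mult_left) (use essbound_kernel_power(1)[OF g z] in simp)
  have point: "(\<lambda>k. f k t) sums (of_real (g t) * ((w - z) / ((of_real t - w) * (of_real t - z))))"
    "summable (\<lambda>k. norm (f k t))" for t
  proof -
    define r where "r = (w - z) / (of_real t - z)"
    have nz: "of_real t - z \<noteq> 0" using of_real_neq_upper[OF z] by simp
    have "cmod (w - z) < cmod (of_real t - z)"
      using w Im_le_cmod_of_real_diff[of z t] by linarith
    then have r: "norm r < 1" using nz by (simp add: r_def norm_divide)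
    have nz': "of_real t - w \<noteq> 0" using \<open>cmod (w - z) < cmod (of_real t - z)\<close> by auto
    have f: "f k t = (of_real (g t) * ((w - z) / (of_real t - z)^2)) * r ^ k" for k
      by (simp add: f_def r_def power_add power_divide power2_eq_square mult.assoc)
    have "(\<lambda>k. f k t) sums ((of_real (g t) * ((w - z) / (of_real t - z)^2)) * (1 / (1 - r)))"
      unfolding f by (intro sums_mult geometric_sums r)
    moreover have "1 / (1 - r) = (of_real t - z) / (of_real t - w)"
      using nz nz' by (simp add: r_def field_simps)
    ultimately show "(\<lambda>k. f k t) sums (of_real (g t) * ((w - z) / ((of_real t - w) * (of_real t - z))))"
      using nz by (simp add: power2_eq_square mult.commute)
    show "summable (\<lambda>k. norm (f k t))"
      unfolding f norm_mult norm_power using r by (intro summable_mult summable_geometric) auto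
  qed
  \<comment> \<open>The L1 norms of the terms are dominated by a geometric series with ratio
    \<open>q\<close> < 1, which permits exchanging sum and integral.\<close>
  have "summable (\<lambda>k. LINT t|lebesgue. norm (f k t))"
  proof (rule summable_comparison_test')
    show "summable (\<lambda>k. (C * cmod (w - z)) * q ^ k)"
      using q by (intro summable_mult summable_geometric) auto
    fix k
    have "(LINT t|lebesgue. norm (f k t)) =
        (LINT t|lebesgue. norm (of_real (g t) * (1 / (of_real t - z) ^ (k + 2)))) * cmod (w - z) ^ (k + 1)"
      unfolding f_def norm_mult[of "of_real _ * _"] norm_power by (rule integral_mult_left_zero)
    also have "\<dots> \<le> (C / Im z ^ k) * cmod (w - z) ^ (k + 1)"
      unfolding C_def by (intro mult_right_mono essbound_kernel_power(2)[OF g z]) auto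
    also have "\<dots> = (C * cmod (w - z)) * q ^ k" by (simp add: q_def power_divide)
    finally show "norm (LINT t|lebesgue. norm (f k t)) \<le> (C * cmod (w - z)) * q ^ k"
      by simp
  qed
  then have "(\<lambda>k. integral\<^sup>L lebesgue (f k)) sums (LINT t|lebesgue. (\<Sum>k. f k t))"
    by (intro sums_integral fI) (use point in auto)
  also have "(LINT t|lebesgue. (\<Sum>k. f k t)) = cauchy_transform g z w"
    unfolding cauchy_transform_def using sums_unique[OF point(1)] by simp
  also have "(\<lambda>k. integral\<^sup>L lebesgue (f k)) = (\<lambda>k. cauchy_coeff g z (Suc k) * (w - z) ^ Suc k)"
    unfolding f_def cauchy_coeff_def integral_mult_left_zero by simp
  finally have "(\<lambda>k. (if Suc k = 0 then 0 else cauchy_coeff g z (Suc k)) * (w - z) ^ (Suc k)) sums cauchy_transform g z w"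
    by simp
  then show ?thesis
    by (subst (asm) sums_Suc_iff) simp
qed

section \<open>Holomorphy and higher derivatives of the Cauchy transform\<close>

lemma cauchy_transform_holomorphic_ball:
  assumes g: "essbound g M"
  shows "cauchy_transform g z holomorphic_on ball z (Im z)"
  by (rule power_series_holomorphic[OF cauchy_transform_sums[OF g]])
    (auto simp: dist_norm norm_minus_commute)

lemma power_series_higher_deriv:
  fixes f :: "complex \<Rightarrow> complex"
  assumes r: "r > 0" and s: "\<And>w. w \<in> ball z r \<Longrightarrow> (\<lambda>n. a n * (w - z) ^ n) sums f w"
  shows "(deriv ^^ n) f z = fact n * a n"
proof -
  have "(\<lambda>x. f (z + x)) has_fps_expansion Abs_fps a"
    unfolding has_fps_expansion_def
  proof
    \<comment> \<open>Convergence at one nonzero point inside the disc already forces a positive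
      radius; r / 2 is such a point.\<close>
    have "r / 2 \<le> fps_conv_radius (Abs_fps a)"
      unfolding fps_conv_radius_def
    proof (rule order_trans[OF _ conv_radius_geI])
      show "ereal (r / 2) \<le> ereal (norm (of_real (r / 2) :: complex))" using r by simp
      show "summable (\<lambda>n. fps_nth (Abs_fps a) n * of_real (r / 2) ^ n)"
        using s[of "z + of_real (r / 2)"] r by (auto simp: dist_norm sums_iff simp del: of_real_divide)
    qed
    then show "0 < fps_conv_radius (Abs_fps a)"
      using r by (metis ereal_less(2) half_gt_zero less_le_trans)
    have "eventually (\<lambda>x. x \<in> ball 0 r) (nhds (0::complex))"
      using r by (intro eventually_nhds_in_open) auto
    then show "\<forall>\<^sub>F x in nhds 0. eval_fps (Abs_fps a) x = f (z + x)"
    proof eventually_elim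
      case (elim x)
      then show ?case using s[of "z + x"] by (simp add: eval_fps_def sums_iff dist_norm)
    qed
  qed
  from fps_nth_fps_expansion[OF this, of n] show ?thesis
    by (simp add: higher_deriv_shift_0[of n f z] o_def)
qed

lemma higher_deriv_cauchy_transform:
  assumes g: "essbound g M" and "Im z > 0" "n > 0"
  shows "(deriv ^^ n) (cauchy_transform g z) z = fact n * cauchy_coeff g z n"
  using power_series_higher_deriv[OF assms(2) cauchy_transform_sums[OF g], of z n] assms(3)
  by (auto simp: dist_norm norm_minus_commute)

lemma ball_subset_upper_half_plane: "ball z (Im z) \<subseteq> upper_half_plane"
proof
  fix w assume "w \<in> ball z (Im z)"
  then show "w \<in> upper_half_plane"
    using abs_Im_le_cmod[of "z - w"] by (auto simp: upper_half_plane_def dist_norm)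
qed

lemma cauchy_transform_analytic:
  assumes g: "essbound g M" and z: "Im z > 0"
  shows "cauchy_transform g z analytic_on upper_half_plane"
  unfolding analytic_on_def
proof
  fix v assume v: "v \<in> upper_half_plane"
  then have v': "Im v > 0" by (simp add: upper_half_plane_def)
  have "(\<lambda>w. cauchy_transform g z v + cauchy_transform g v w) holomorphic_on ball v (Im v)"
    by (intro holomorphic_intros cauchy_transform_holomorphic_ball[OF g])
  then have "cauchy_transform g z holomorphic_on ball v (Im v)"
    by (rule holomorphic_transform)
      (use ball_subset_upper_half_plane[of v] cauchy_transform_split[OF g z v'] in
       \<open>auto simp: upper_half_plane_def\<close>)
  then show "\<exists>e>0. cauchy_transform g z holomorphic_on ball v e" using v' by blast
qed

section \<open>Analytic functions whose real part is a Poisson integral\<close>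

lemma poisson_eq_Im:
  "Im z / ((Re z - t)\<^sup>2 + (Im z)\<^sup>2) = Im (1 / (of_real t - z))"
  by (simp add: Im_divide power2_commute[of t])

text \<open>The Poisson kernel is the imaginary part of the Cauchy kernel, and division by \<i>
  turns imaginary parts into real ones. The added constant restores what the subtraction at the base
  point removed.\<close>

lemma Re_cauchy_transform:
  assumes g: "essbound g M" and z: "Im z > 0" and w: "Im w > 0"
  shows "Re (cauchy_transform g z w / (of_real pi * \<i>) + of_real (poisson_integral g z)) = poisson_integral g w"
proof -
  have P: "integrable lebesgue (\<lambda>t. Im z * g t / ((Re z - t)\<^sup>2 + (Im z)\<^sup>2))" if z: "Im z > 0" for z
  proof -
    have "integrable lebesgue (\<lambda>t. of_real (g t) * of_real (Im z / (cmod (of_real t - z))\<^sup>2) :: complex)"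
      by (rule essbound_integrable(1)[OF g _ integrable_mult_right[OF integrable_inverse_dist_square[OF z], of "Im z"]])
        (measurable, use z in \<open>auto simp: norm_divide norm_power\<close>)
    then have "integrable lebesgue (\<lambda>t. Re (of_real (g t) * of_real (Im z / (cmod (of_real t - z))\<^sup>2) :: complex))"
      by (rule integrable_Re)
    then show ?thesis
      by (simp add: cmod_power2 power2_commute[of "Re z"] mult.commute)
  qed
  have "Im (cauchy_transform g z w) =
     (LINT t|lebesgue. Im (of_real (g t) * ((w - z) / ((of_real t - w) * (of_real t - z)))))"
    unfolding cauchy_transform_def by (rule integral_Im[symmetric]) (rule essbound_kernel_product[OF g z w])
  also have "\<dots> = (LINT t|lebesgue. Im w * g t / ((Re w - t)\<^sup>2 + (Im w)\<^sup>2) - Im z * g t / ((Re z - t)\<^sup>2 + (Im z)\<^sup>2))"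
  proof (rule Bochner_Integration.integral_cong[OF refl])
    fix t
    have "(w - z) / ((of_real t - w) * (of_real t - z)) = 1 / (of_real t - w) - 1 / (of_real t - z)"
      using of_real_neq_upper[OF z, of t] of_real_neq_upper[OF w, of t]
      by (simp add: divide_simps)
    then have "Im (of_real (g t) * ((w - z) / ((of_real t - w) * (of_real t - z))))
       = g t * (Im (1 / (of_real t - w)) - Im (1 / (of_real t - z)))"
      by (simp only: Im_complex_of_real Re_complex_of_real times_complex.sel minus_complex.sel)
    then show "Im (of_real (g t) * ((w - z) / ((of_real t - w) * (of_real t - z)))) =
       Im w * g t / ((Re w - t)\<^sup>2 + (Im w)\<^sup>2) - Im z * g t / ((Re z - t)\<^sup>2 + (Im z)\<^sup>2)"
      unfolding poisson_eq_Im[of z, symmetric] poisson_eq_Im[of w, symmetric]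
      by (simp add: right_diff_distrib mult.commute)
  qed
  also have "\<dots> = pi * poisson_integral g w - pi * poisson_integral g z"
    unfolding poisson_integral_def
    by (subst Bochner_Integration.integral_diff[OF P[OF w] P[OF z]]) simp
  finally have "Im (cauchy_transform g z w) = pi * (poisson_integral g w - poisson_integral g z)"
    by (simp add: algebra_simps)
  then show ?thesis by (simp add: Re_divide power2_eq_square)
qed

text \<open>A nonconstant holomorphic map would have an open image, but no disc fits into the
  imaginary axis.\<close>

lemma holomorphic_Re_0_imp_constant:
  assumes h: "h holomorphic_on S" and S: "open S" "connected S" and Re: "\<And>w. w \<in> S \<Longrightarrow> Re (h w) = 0"
  shows "h constant_on S"
proof (rule ccontr)
  assume nc: "\<not> h constant_on S"
  then obtain w where w: "w \<in> S" by (auto simp: constant_on_def)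
  have "open (h ` S)" by (rule open_mapping_thm[OF h S S(1) order.refl nc])
  then obtain e where e: "e > 0" "ball (h w) e \<subseteq> h ` S"
    using w open_contains_ball by blast
  have "h w + of_real (e / 2) \<in> ball (h w) e" using e by (simp add: dist_norm)
  then obtain v where v: "v \<in> S" "h v = h w + of_real (e / 2)" using e by (metis imageE subsetD)
  then have "Re (h v) = Re (h w) + e / 2" by simp
  then show False using Re v(1) w e by simp
qed

text \<open>On the disc around \<open>z\<close>, \<open>f\<close> and the normalized Cauchy
  transform have real parts that differ by a constant, so the functions themselves differ by a
  constant. Derivatives of positive order do not see it.\<close>

lemma higher_deriv_of_poisson:
  assumes f: "f analytic_on upper_half_plane" and g: "essbound g M"
    and Re: "\<And>w. w \<in> upper_half_plane \<Longrightarrow> Re (f w) = poisson_integral g w"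
    and z: "Im z > 0" and n: "n > 0"
  shows "(deriv ^^ n) f z = fact n / (of_real pi * \<i>) * cauchy_coeff g z n"
proof -
  let ?B = "ball z (Im z)" and ?d = "of_real pi * \<i>"
  define F where "F w = (1 / ?d) * cauchy_transform g z w" for w
  have F: "F holomorphic_on ?B" unfolding F_def
    by (intro holomorphic_intros cauchy_transform_holomorphic_ball[OF g])
  have fB: "f holomorphic_on ?B"
    using f ball_subset_upper_half_plane analytic_imp_holomorphic holomorphic_on_subset by blast
  define h where "h w = f w - F w - of_real (poisson_integral g z)" for w
  have "h holomorphic_on ?B" unfolding h_def by (intro holomorphic_intros F fB)
  moreover have "Re (h w) = 0" if "w \<in> ?B" for w
  proof -
    have w: "w \<in> upper_half_plane" using that ball_subset_upper_half_plane by blast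
    then have "Re (F w + of_real (poisson_integral g z)) = poisson_integral g w"
      using Re_cauchy_transform[OF g z, of w] unfolding F_def
      by (simp add: upper_half_plane_def del: plus_complex.sel)
    then show ?thesis using Re[OF w] by (simp add: h_def)
  qed
  ultimately have "h constant_on ?B"
    by (intro holomorphic_Re_0_imp_constant) auto
  then obtain c where "\<And>w. w \<in> ?B \<Longrightarrow> h w = c" unfolding constant_on_def by auto
  then have c: "\<And>w. w \<in> ?B \<Longrightarrow> f w = F w + (c + of_real (poisson_integral g z))"
    unfolding h_def by (simp add: algebra_simps)
  have zB: "z \<in> ?B" using z by simp
  have "(deriv ^^ n) f z = (deriv ^^ n) (\<lambda>w. F w + (c + of_real (poisson_integral g z))) z"
    by (rule higher_deriv_transform_within_open[OF fB _ open_ball zB c])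
      (intro holomorphic_intros F)
  also have "\<dots> = (deriv ^^ n) F z"
    by (subst higher_deriv_add[OF F _ open_ball zB]) (use n in auto)
  also have "\<dots> = (1 / ?d) * (deriv ^^ n) (cauchy_transform g z) z"
    unfolding F_def by (rule higher_deriv_cmult[OF cauchy_transform_holomorphic_ball[OF g] zB open_ball])
  also have "\<dots> = fact n / ?d * cauchy_coeff g z n"
    using higher_deriv_cauchy_transform[OF g z n] by simp
  finally show ?thesis .
qed

subsection \<open>Oscillatory integrals against powers of the cosine\<close>

lemma ex_antiderivative_real:
  fixes f :: "real \<Rightarrow> real"
  assumes "continuous_on UNIV f"
  shows "\<exists>F. \<forall>x. (F has_real_derivative f x) (at x)"
proof -
  have "\<exists>F. \<forall>x :: real. (-\<infinity>::ereal) < x \<longrightarrow> x < (\<infinity>::ereal) \<longrightarrow> (F has_vector_derivative f x) (at x)"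
    by (rule einterval_antiderivative)
      (use assms in \<open>auto simp: continuous_on_eq_continuous_at\<close>)
  then show ?thesis by (simp add: has_real_derivative_iff_has_vector_derivative)
qed

text \<open>The increment F (x + d) - F x has derivative 0, so its vanishing at the single point
  \<open>a\<close> makes it vanish everywhere.\<close>

lemma antiderivative_periodic:
  fixes F :: "real \<Rightarrow> real"
  assumes F: "\<And>x. (F has_real_derivative f x) (at x)"
    and f: "\<And>x. f (x + d) = f x" and eq: "F (a + d) = F a"
  shows "F (x + d) = F x"
proof -
  have "((\<lambda>x. F (x + d) - F x) has_real_derivative 0) (at x)" for x
  proof -
    have "((\<lambda>x. F (x + d)) has_real_derivative f (x + d)) (at x)"
      using F[of "x + d"] DERIV_shift by blast
    then have "((\<lambda>x. F (x + d) - F x) has_real_derivative f (x + d) - f x) (at x)"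
      by (intro derivative_intros F)
    then show ?thesis by (simp add: f)
  qed
  then have "F (x + d) - F x = F (a + d) - F a"
    by (intro DERIV_const_ratio_const DERIV_isconst_all allI) auto
  then show ?thesis using eq by simp
qed

lemma bounded_periodic:
  fixes G :: "real \<Rightarrow> real"
  assumes c: "continuous_on UNIV G" and p: "\<And>x. G (x + d) = G x" and d: "d > 0"
  obtains B where "\<And>x. \<bar>G x\<bar> \<le> B"
proof -
  interpret periodic_fun_simple G d by standard (rule p)
  have "compact (G ` {0..d})"
    by (intro compact_continuous_image continuous_on_subset[OF c]) auto
  then obtain B where "\<forall>v \<in> G ` {0..d}. norm v \<le> B"
    using compact_imp_bounded bounded_iff by blast
  then have B: "\<And>y. y \<in> {0..d} \<Longrightarrow> \<bar>G y\<bar> \<le> B" by simp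
  have "\<bar>G x\<bar> \<le> B" for x
  proof -
    define y where "y = x - of_int \<lfloor>x / d\<rfloor> * d"
    have "of_int \<lfloor>x / d\<rfloor> * d \<le> x" "x \<le> (of_int \<lfloor>x / d\<rfloor> + 1) * d"
      using floor_divide_lower[OF d, of x] floor_divide_upper[OF d, of x] by simp_all
    then have "y \<in> {0..d}" by (auto simp: y_def algebra_simps)
    moreover have "G y = G x" unfolding y_def by (rule minus_of_int)
    ultimately show ?thesis using B[of y] by simp
  qed
  then show ?thesis using that by blast
qed

text \<open>The second antiderivative of \<open>\<bar>cos x\<bar> - 2 / pi\<close> stays bounded because \<open>2 / pi\<close> is the mean
  of \<open>\<bar>cos x\<bar>\<close> and the first antiderivative that vanishes at 0 is odd.\<close>
lemma ex_bounded_second_antiderivative_abs_cos: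
  obtains F G :: "real \<Rightarrow> real" and B where
    "\<And>x. (F has_real_derivative \<bar>cos x\<bar> - 2 / pi) (at x)"
    "\<And>x. (G has_real_derivative F x) (at x)"
    "\<And>x. \<bar>G x\<bar> \<le> B"
proof -
  let ?S = "{-pi/2..pi/2}"
  obtain F0 where F0: "\<And>x. (F0 has_real_derivative \<bar>cos x\<bar> - 2 / pi) (at x)"
  proof -
    have "continuous_on UNIV (\<lambda>x::real. \<bar>cos x\<bar> - 2 / pi)" by (intro continuous_intros)
    from ex_antiderivative_real[OF this] show thesis using that by blast
  qed
  define F where "F x = F0 x - F0 0" for x
  have F: "(F has_real_derivative \<bar>cos x\<bar> - 2 / pi) (at x)" for x
    unfolding F_def using DERIV_diff[OF F0[of x] DERIV_const] by simp
  have "\<exists>c. \<forall>x\<in>?S. F x - (sin x - 2 * x / pi) = c"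
  proof (rule has_field_derivative_zero_constant)
    fix x assume "x \<in> ?S"
    then have "cos x \<ge> 0" by (intro cos_ge_zero) auto
    then have "\<bar>cos x\<bar> - 2 / pi - (cos x - 2 * 1 / pi) = 0" by simp
    moreover have "((\<lambda>x. F x - (sin x - 2 * x / pi)) has_real_derivative
        \<bar>cos x\<bar> - 2 / pi - (cos x - 2 * 1 / pi)) (at x)"
      by (intro DERIV_diff F DERIV_sin DERIV_cdivide DERIV_cmult DERIV_ident)
    ultimately show "((\<lambda>x. F x - (sin x - 2 * x / pi)) has_real_derivative 0) (at x within ?S)"
      by (simp only: has_field_derivative_at_within)
  qed auto
  then obtain c where c: "\<And>x. x \<in> ?S \<Longrightarrow> F x - (sin x - 2 * x / pi) = c" by blast
  have "c = 0" using c[of 0] by (simp add: F_def)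
  then have Fx: "F x = sin x - 2 * x / pi" if "x \<in> ?S" for x using c[OF that] by simp
  have "continuous_on UNIV F"
    by (rule DERIV_continuous_on) (rule F)
  then obtain G where G: "\<And>x. (G has_real_derivative F x) (at x)"
    using ex_antiderivative_real[of F] by metis
  have "\<exists>c. \<forall>x\<in>?S. G x - (- cos x - x\<^sup>2 / pi) = c"
  proof (rule has_field_derivative_zero_constant)
    fix x assume "x \<in> ?S"
    then have "F x - (sin x - 2 * x / pi) = 0" by (simp add: Fx)
    moreover have "((\<lambda>x. - cos x - x\<^sup>2 / pi) has_real_derivative sin x - 2 * x / pi) (at x)"
      by (auto intro!: derivative_eq_intros)
    from DERIV_diff[OF G this] have "((\<lambda>x. G x - (- cos x - x\<^sup>2 / pi)) has_real_derivative F x - (sin x - 2 * x / pi)) (at x)" .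
    ultimately show "((\<lambda>x. G x - (- cos x - x\<^sup>2 / pi)) has_real_derivative 0) (at x within ?S)"
      by (simp only: has_field_derivative_at_within)
  qed auto
  then obtain c' where c': "\<And>x. x \<in> ?S \<Longrightarrow> G x - (- cos x - x\<^sup>2 / pi) = c'" by blast
  \<comment> \<open>At x = pi/2 and x = -pi/2 one has sin x = 2 x / pi, so \<open>F\<close> vanishes
    at both ends of a period. This is where the mean 2 / pi is forced; \<open>G\<close> agrees at
    both ends because its explicit form is even.\<close>
  have "F (x + pi) = F x" for x
    by (rule antiderivative_periodic[OF F, of _ "-pi/2"]) (simp_all add: Fx)
  moreover have "G (-pi/2 + pi) = G (-pi/2)"
    using c'[of "pi/2"] c'[of "-pi/2"] by simp
  ultimately have "G (x + pi) = G x" for x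
    by (rule antiderivative_periodic[OF G])
  from bounded_periodic[OF DERIV_continuous_on[OF G] this pi_gt_zero]
  obtain B where B: "\<And>x. \<bar>G x\<bar> \<le> B" by auto
  show ?thesis by (rule that[OF F G B])
qed

section \<open>Cosine moments with and without the oscillating factor\<close>

definition cos_moment :: "nat \<Rightarrow> real" where
  "cos_moment p = integral {-pi/2..pi/2} (\<lambda>x. cos x ^ p)"

lemma has_integral_cos_moment:
  "((\<lambda>x. cos x ^ p) has_integral cos_moment p) {-pi/2..pi/2}"
  unfolding cos_moment_def
  by (intro integrable_integral integrable_continuous_interval continuous_intros)

lemma cos_moment_nonneg: "0 \<le> cos_moment p"
  unfolding cos_moment_def
  by (intro integral_nonneg integrable_continuous_interval continuous_intros zero_le_power)
     (auto intro: cos_ge_zero)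

text \<open>The function differentiated here is the first derivative of cos^(p + 2). Starting from p
  + 2 keeps all exponents natural.\<close>

lemma cos_power_second_derivative:
  "((\<lambda>x. - real (p + 2) * cos x ^ (p + 1) * sin x) has_real_derivative
     real (p + 2) * real (p + 1) * (cos x ^ p * (sin x)\<^sup>2) - real (p + 2) * cos x ^ (p + 2)) (at x)"
  by (rule derivative_eq_intros refl | simp)+ (simp add: algebra_simps power2_eq_square)

text \<open>The derivative of cos^(p + 2) contains cos^(p + 1) and vanishes at both endpoints. Its
  own derivative therefore integrates to 0, and the two terms of that second derivative
  balance.\<close>

lemma has_integral_cos_power_sin_square:
  "((\<lambda>x. real (p + 1) * (cos x ^ p * (sin x)\<^sup>2)) has_integral cos_moment (p + 2)) {-pi/2..pi/2}"
proof -
  have "((\<lambda>x. real (p + 2) * real (p + 1) * (cos x ^ p * (sin x)\<^sup>2) - real (p + 2) * cos x ^ (p + 2)) has_integral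
     (- real (p + 2) * cos (pi/2) ^ (p + 1) * sin (pi/2)) - (- real (p + 2) * cos (-pi/2) ^ (p + 1) * sin (-pi/2))) {-pi/2..pi/2}"
    by (intro fundamental_theorem_of_calculus)
      (simp, rule has_vector_derivative_at_within,
        rule cos_power_second_derivative[unfolded has_real_derivative_iff_has_vector_derivative])
  then have "((\<lambda>x. real (p + 2) * real (p + 1) * (cos x ^ p * (sin x)\<^sup>2) - real (p + 2) * cos x ^ (p + 2)) has_integral 0) {-pi/2..pi/2}"
    by simp
  from has_integral_mult_right[OF has_integral_add[OF this has_integral_mult_right[OF has_integral_cos_moment[of "p + 2"], of "real (p + 2)"]], of "1 / real (p + 2)"]
  have "((\<lambda>x. real (p + 1) * (cos x ^ p * (sin x)\<^sup>2)) has_integral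
      1 / real (p + 2) * (0 + real (p + 2) * cos_moment (p + 2))) {-pi/2..pi/2}"
  proof (rule has_integral_eq[rotated])
    have *: "1 / n * (n * a * X - n * Y + n * Y) = a * X" if "n \<noteq> 0" for n a X Y :: real
      using that by simp
    show "1 / real (p + 2) * (real (p + 2) * real (p + 1) * (cos x ^ p * (sin x)\<^sup>2) - real (p + 2) * cos x ^ (p + 2) + real (p + 2) * cos x ^ (p + 2))
       = real (p + 1) * (cos x ^ p * (sin x)\<^sup>2)" for x
      by (rule *) simp
  qed
  then show ?thesis by simp
qed

lemma cos_moment_rec: "real (p + 2) * cos_moment (p + 2) = real (p + 1) * cos_moment p"
proof -
  have I: "((\<lambda>x. real (p + 1) * cos x ^ p - real (p + 1) * cos x ^ (p + 2)) has_integral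
      real (p + 1) * cos_moment p - real (p + 1) * cos_moment (p + 2)) {-pi/2..pi/2}"
    by (intro has_integral_diff has_integral_mult_right has_integral_cos_moment)
  have "real (p + 1) * cos x ^ p - real (p + 1) * cos x ^ (p + 2) = real (p + 1) * (cos x ^ p * (sin x)\<^sup>2)" for x
    unfolding sin_squared_eq by (simp only: power_add right_diff_distrib mult_1_right)
  from has_integral_unique[OF I[unfolded this] has_integral_cos_power_sin_square]
  show ?thesis by (simp add: algebra_simps)
qed

lemma cos_moment_1: "cos_moment 1 = 2"
proof -
  have "((\<lambda>x. cos x) has_integral sin (pi/2) - sin (-pi/2)) {-pi/2..pi/2}"
    by (intro fundamental_theorem_of_calculus)
      (auto simp flip: has_real_derivative_iff_has_vector_derivative intro!: derivative_eq_intros)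
  then show ?thesis using has_integral_unique[OF has_integral_cos_moment[of 1]] by simp
qed

text \<open>For derivatives of order n = p + 1 the frequency is n + 1 = p + 2 and the weight is
  cos^(n - 1) = cos^p. This is the integral under the maximum in the representation of Kresin and
  Maz'ya, indexed so as to avoid natural subtraction.\<close>

definition abs_cos_moment :: "real \<Rightarrow> nat \<Rightarrow> real" where
  "abs_cos_moment \<beta> p = integral {-pi/2..pi/2} (\<lambda>x. \<bar>cos (\<beta> - real (p + 2) * x)\<bar> * cos x ^ p)"

lemma has_integral_abs_cos_moment:
  "((\<lambda>x. \<bar>cos (\<beta> - real (p + 2) * x)\<bar> * cos x ^ p) has_integral abs_cos_moment \<beta> p) {-pi/2..pi/2}"
  unfolding abs_cos_moment_def
  by (intro integrable_integral integrable_continuous_interval continuous_intros)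

text \<open>Two integrations by parts gain N^(-2) with N = p + 4, while the second derivative of the
  weight costs only a factor of order p in the L1 norm, relative to the weight. The net relative
  error is O(1 / N), uniform in \<beta> because \<open>G\<close> is bounded on the whole
  line.\<close>

lemma abs_cos_moment_estimate:
  obtains B where "B \<ge> 0"
    "\<And>\<beta> p. \<bar>abs_cos_moment \<beta> (p + 2) - 2 / pi * cos_moment (p + 2)\<bar> \<le> B / real (p + 4) * cos_moment (p + 2)"
proof -
  obtain F G :: "real \<Rightarrow> real" and B where
    F: "\<And>x. (F has_real_derivative \<bar>cos x\<bar> - 2 / pi) (at x)" and
    G: "\<And>x. (G has_real_derivative F x) (at x)" and
    B: "\<And>x. \<bar>G x\<bar> \<le> B"
    by (rule ex_bounded_second_antiderivative_abs_cos) (rule that)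
  have B0: "B \<ge> 0" using B[of 0] by linarith
  have "\<bar>abs_cos_moment \<beta> (p + 2) - 2 / pi * cos_moment (p + 2)\<bar> \<le> 2 * B / real (p + 4) * cos_moment (p + 2)" for \<beta> p
  proof -
    define N where "N = real (p + 4)"
    have N: "N > 0" by (simp add: N_def)
    define w where "w x = cos x ^ (p + 2)" for x :: real
    define w' where "w' x = - real (p + 2) * cos x ^ (p + 1) * sin x" for x
    \<comment> \<open>Scaled so that \<open>u\<close> and \<open>w\<close> have the same integral;
      hence |w''| integrates to at most 2 (p + 2) times that integral.\<close>
    define u where "u x = real (p + 1) * (cos x ^ p * (sin x)\<^sup>2)" for x
    define w'' where "w'' x = real (p + 2) * u x - real (p + 2) * w x" for x
    have w: "(w has_real_derivative w' x) (at x)" for x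
      unfolding w_def w'_def
      by (rule DERIV_cong[OF DERIV_power[OF DERIV_cos]]) (simp add: algebra_simps)
    have w': "(w' has_real_derivative w'' x) (at x)" for x
      using cos_power_second_derivative[of p x]
      unfolding w'_def[abs_def] w''_def u_def w_def by (simp only: mult.assoc)
    \<comment> \<open>The boundary terms of both integrations by parts. They vanish at the endpoints
      because \<open>w\<close> and \<open>w'\<close> contain positive powers of the cosine.\<close>
    define \<Phi> where "\<Phi> x = - (1 / N) * F (\<beta> - N * x) * w x - (1 / N\<^sup>2) * G (\<beta> - N * x) * w' x" for x
    define h where "h x = (\<bar>cos (\<beta> - N * x)\<bar> - 2 / pi) * w x" for x
    have lin: "((\<lambda>x. \<beta> - N * x) has_real_derivative - N) (at x)" for x
      by (auto intro!: derivative_eq_intros)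
    have "(\<Phi> has_real_derivative h x - (1 / N\<^sup>2) * G (\<beta> - N * x) * w'' x) (at x)" for x
    proof -
      have F': "((\<lambda>x. F (\<beta> - N * x)) has_real_derivative (\<bar>cos (\<beta> - N * x)\<bar> - 2 / pi) * - N) (at x)"
        by (rule DERIV_chain2[OF F lin])
      have G': "((\<lambda>x. G (\<beta> - N * x)) has_real_derivative F (\<beta> - N * x) * - N) (at x)"
        by (rule DERIV_chain2[OF G lin])
      show ?thesis
        unfolding \<Phi>_def h_def
        by (rule DERIV_cong[OF DERIV_diff[OF DERIV_mult[OF DERIV_cmult[OF F'] w] DERIV_mult[OF DERIV_cmult[OF G'] w']]])
          (use N in \<open>simp add: field_simps power2_eq_square\<close>)
    qed
    then have "((\<lambda>x. h x - (1 / N\<^sup>2) * G (\<beta> - N * x) * w'' x) has_integral \<Phi> (pi/2) - \<Phi> (-pi/2)) {-pi/2..pi/2}"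
      by (intro fundamental_theorem_of_calculus)
        (auto simp flip: has_real_derivative_iff_has_vector_derivative intro: has_field_derivative_at_within)
    also have "\<Phi> (pi/2) - \<Phi> (-pi/2) = 0" by (simp add: \<Phi>_def w_def w'_def)
    finally have I1: "((\<lambda>x. h x - (1 / N\<^sup>2) * G (\<beta> - N * x) * w'' x) has_integral 0) {-pi/2..pi/2}" .
    have "((\<lambda>x. \<bar>cos (\<beta> - real (p + 2 + 2) * x)\<bar> * cos x ^ (p + 2) - 2 / pi * cos x ^ (p + 2)) has_integral
        abs_cos_moment \<beta> (p + 2) - 2 / pi * cos_moment (p + 2)) {-pi/2..pi/2}"
      by (intro has_integral_diff has_integral_mult_right has_integral_cos_moment has_integral_abs_cos_moment)
    then have I2: "(h has_integral abs_cos_moment \<beta> (p + 2) - 2 / pi * cos_moment (p + 2)) {-pi/2..pi/2}"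
      by (rule has_integral_eq[rotated]) (simp add: h_def w_def N_def algebra_simps)
    have I3: "((\<lambda>x. (1 / N\<^sup>2) * G (\<beta> - N * x) * w'' x) has_integral
        abs_cos_moment \<beta> (p + 2) - 2 / pi * cos_moment (p + 2)) {-pi/2..pi/2}"
      using has_integral_diff[OF I2 I1] by simp
    have I4: "((\<lambda>x. (B / N\<^sup>2 * real (p + 2)) * (u x + w x)) has_integral
       (B / N\<^sup>2 * real (p + 2)) * (cos_moment (p + 2) + cos_moment (p + 2))) {-pi/2..pi/2}"
      unfolding u_def w_def
      by (intro has_integral_mult_right has_integral_add has_integral_cos_power_sin_square has_integral_cos_moment)
    have "norm (abs_cos_moment \<beta> (p + 2) - 2 / pi * cos_moment (p + 2)) \<le>
       (B / N\<^sup>2 * real (p + 2)) * (cos_moment (p + 2) + cos_moment (p + 2))"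
    proof -
      have "norm ((1 / N\<^sup>2) * G (\<beta> - N * x) * w'' x) \<le> (B / N\<^sup>2 * real (p + 2)) * (u x + w x)"
        if "x \<in> {-pi/2..pi/2}" for x
      proof -
        have c: "cos x \<ge> 0" using that by (intro cos_ge_zero) auto
        have "0 \<le> u x" "0 \<le> w x" using c by (auto simp: u_def w_def)
        then have "\<bar>w'' x\<bar> \<le> real (p + 2) * (u x + w x)"
          unfolding w''_def by (simp add: abs_if distrib_left) 
        then have "\<bar>G (\<beta> - N * x)\<bar> * \<bar>w'' x\<bar> \<le> B * (real (p + 2) * (u x + w x))"
          using B B0 by (intro mult_mono) auto
        then have "(1 / N\<^sup>2) * (\<bar>G (\<beta> - N * x)\<bar> * \<bar>w'' x\<bar>) \<le> (1 / N\<^sup>2) * (B * (real (p + 2) * (u x + w x)))"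
          by (intro mult_left_mono) auto
        then show ?thesis by (simp add: abs_mult)
      qed
      then show ?thesis
        using integral_norm_bound_integral[OF has_integral_integrable[OF I3] has_integral_integrable[OF I4]]
          integral_unique[OF I3] integral_unique[OF I4] by metis
    qed
    also have "\<dots> = (2 * B / N * cos_moment (p + 2)) * (real (p + 2) / N)"
      using N by (simp add: power2_eq_square)
    also have "\<dots> \<le> (2 * B / N * cos_moment (p + 2)) * 1"
      using N B0 cos_moment_nonneg by (intro mult_left_mono) (auto simp: N_def)
    finally show ?thesis by (simp add: N_def)
  qed
  then show ?thesis using that[of "2 * B"] B0 by simp
qed

subsection \<open>Bounds for the sharp constant\<close>

text \<open>With t = Re z + Im z tan x one has t - z = (Im z / cos x) cis (x - pi/2), so powers of
  the kernel become powers of the cosine times a phase. The Jacobian Im z / (cos x)^2 cancels two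
  cosine factors and leaves cos^p.\<close>

lemma kernel_at_tan:
  assumes y: "Im z > 0" and x: "x \<in> {-pi/2<..<pi/2}"
  shows "\<bar>Im z / (cos x)\<^sup>2\<bar> * \<bar>Re (cis \<alpha> / (of_real (Re z + Im z * tan x) - z) ^ (p + 2))\<bar>
     = (1 / Im z ^ (p + 1)) * (\<bar>cos (\<alpha> + real (p + 2) * (pi / 2) - real (p + 2) * x)\<bar> * cos x ^ p)"
proof -
  have c: "cos x > 0" using x by (intro cos_gt_zero_pi) auto
  have "of_real (Re z + Im z * tan x) - z = of_real (Im z / cos x) * cis (x - pi / 2)"
    using c by (simp add: complex_eq_iff tan_def cos_diff sin_diff)
  moreover have "inverse (of_real (Im z / cos x) * cis (x - pi / 2)) = of_real (cos x / Im z) * cis (pi / 2 - x)"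
    unfolding inverse_mult_distrib cis_inverse of_real_inverse[symmetric] by simp
  ultimately have inv: "inverse (of_real (Re z + Im z * tan x) - z) = of_real (cos x / Im z) * cis (pi / 2 - x)"
    by (simp only:)
  have "cis \<alpha> / (of_real (Re z + Im z * tan x) - z) ^ (p + 2)
      = cis \<alpha> * inverse (of_real (Re z + Im z * tan x) - z) ^ (p + 2)"
    by (simp only: divide_inverse power_inverse)
  also have "\<dots> = cis \<alpha> * (of_real ((cos x / Im z) ^ (p + 2)) * cis (real (p + 2) * (pi / 2 - x)))"
    unfolding inv power_mult_distrib Complex.DeMoivre of_real_power by (rule refl)
  also have "\<dots> = of_real ((cos x / Im z) ^ (p + 2)) * cis (\<alpha> + real (p + 2) * (pi / 2 - x))"
    by (simp only: mult.left_commute[of "cis \<alpha>"] cis_mult)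
  finally have "cis \<alpha> / (of_real (Re z + Im z * tan x) - z) ^ (p + 2)
      = of_real ((cos x / Im z) ^ (p + 2)) * cis (\<alpha> + real (p + 2) * (pi / 2 - x))" .
  then have ReK: "Re (cis \<alpha> / (of_real (Re z + Im z * tan x) - z) ^ (p + 2))
      = (cos x / Im z) ^ (p + 2) * cos (\<alpha> + real (p + 2) * (pi / 2) - real (p + 2) * x)"
    by (simp only: Re_complex_of_real Im_complex_of_real times_complex.sel cis.sel right_diff_distrib
        mult_zero_left diff_zero add_diff_eq)
  have GP: "Im z / (cos x)\<^sup>2 * (cos x / Im z) ^ (p + 2) = (1 / Im z ^ (p + 1)) * cos x ^ p"
    using c y by (simp add: power_divide power2_eq_square)
  have *: "\<bar>G\<bar> * \<bar>P * C\<bar> = k * (\<bar>C\<bar> * d)" if "G * P = k * d" "G \<ge> 0" "P \<ge> 0" for G P C k d :: real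
  proof -
    have "\<bar>G\<bar> * \<bar>P * C\<bar> = (G * P) * \<bar>C\<bar>" using that(2,3) by (simp add: abs_mult)
    then show ?thesis unfolding that(1) by (simp add: mult_ac)
  qed
  show ?thesis unfolding ReK by (rule *[OF GP]) (use c y in simp_all)
qed

text \<open>The tangent substitution maps the open interval bijectively onto the line. Change of
  variables is used as an equivalence, so integrability on the line and the value of the integral
  come out together.\<close>

lemma abs_Re_kernel_integral:
  assumes y: "Im z > 0"
  shows "integrable lebesgue (\<lambda>t. \<bar>Re (cis \<alpha> / (of_real t - z) ^ (p + 2))\<bar>)" (is ?I)
    and "(LINT t|lebesgue. \<bar>Re (cis \<alpha> / (of_real t - z) ^ (p + 2))\<bar>)
       = abs_cos_moment (\<alpha> + real (p + 2) * (pi / 2)) p / Im z ^ (p + 1)" (is ?E)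
proof -
  let ?S = "{-pi/2<..<pi/2}" and ?\<beta> = "\<alpha> + real (p + 2) * (pi / 2)"
  define g where "g x = Re z + Im z * tan x" for x
  define h where "h t = \<bar>Re (cis \<alpha> / (of_real t - z) ^ (p + 2))\<bar>" for t
  let ?g' = "\<lambda>x. Im z / (cos x)\<^sup>2"
  let ?k = "\<lambda>x. (1 / Im z ^ (p + 1)) * (\<bar>cos (?\<beta> - real (p + 2) * x)\<bar> * cos x ^ p)"
  let ?b = "(1 / Im z ^ (p + 1)) * abs_cos_moment ?\<beta> p"
  have c: "cos x > 0" if "x \<in> ?S" for x using that by (intro cos_gt_zero_pi) auto
  have k: "\<bar>?g' x\<bar> * h (g x) = ?k x" if "x \<in> ?S" for x
    using kernel_at_tan[OF y that] by (simp only: g_def h_def)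
  have "(?k has_integral ?b) {-pi/2..pi/2}"
    by (intro has_integral_mult_right has_integral_abs_cos_moment)
  \<comment> \<open>The endpoints, where the tangent has its poles, are dropped without changing the
    integral.\<close>
  then have "(?k has_integral ?b) ?S" by (simp only: has_integral_Icc_iff_Ioo)
  then have K: "((\<lambda>x. \<bar>?g' x\<bar> * h (g x)) has_integral ?b) ?S"
    by (rule has_integral_eq[rotated]) (simp only: k)
  have aK: "(\<lambda>x. \<bar>?g' x\<bar> * h (g x)) absolutely_integrable_on ?S"
    by (rule nonnegative_absolutely_integrable_1[OF has_integral_integrable[OF K]]) (simp add: h_def)
  have A: "(\<lambda>x. \<bar>?g' x\<bar> * h (g x)) absolutely_integrable_on ?S \<and> integral ?S (\<lambda>x. \<bar>?g' x\<bar> * h (g x)) = ?b"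
    by (rule conjI[OF aK integral_unique[OF K]])
  have inj: "inj_on g ?S"
  proof (rule inj_onI)
    fix u v assume uv: "u \<in> ?S" "v \<in> ?S" "g u = g v"
    then have t: "tan u = tan v" using y by (simp add: g_def)
    have "arctan (tan u) = u" by (rule arctan_tan) (use uv(1) in auto)
    moreover have "arctan (tan v) = v" by (rule arctan_tan) (use uv(2) in auto)
    ultimately show "u = v" unfolding t by (rule trans[OF sym])
  qed
  have der: "(g has_real_derivative ?g' x) (at x within ?S)" if "x \<in> ?S" for x
  proof -
    have "(tan has_real_derivative inverse ((cos x)\<^sup>2)) (at x within ?S)"
      by (rule has_field_derivative_at_within, rule DERIV_tan) (use c[OF that] in simp)
    from DERIV_add[OF DERIV_const DERIV_cmult[OF this]] show ?thesis
      unfolding g_def[abs_def] divide_inverse add_0 .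
  qed
  have img: "g ` ?S = UNIV"
  proof -
    have "t \<in> g ` ?S" for t
    proof (rule image_eqI)
      show "t = g (arctan ((t - Re z) / Im z))" using y by (simp add: g_def tan_arctan)
      show "arctan ((t - Re z) / Im z) \<in> ?S" using arctan_bounded[of "(t - Re z) / Im z"] by simp
    qed
    then show ?thesis by (simp add: set_eq_iff)
  qed
  have "?S \<in> sets lebesgue" by simp
  then have "((\<lambda>x. \<bar>?g' x\<bar> * h (g x)) absolutely_integrable_on ?S \<and> integral ?S (\<lambda>x. \<bar>?g' x\<bar> * h (g x)) = ?b)
      \<longleftrightarrow> (h absolutely_integrable_on g ` ?S \<and> integral (g ` ?S) h = ?b)"
    by (rule has_absolute_integral_change_of_variables_1'[OF _ _ inj]) (rule der)
  from iffD1[OF this A]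
  have "h absolutely_integrable_on g ` ?S \<and> integral (g ` ?S) h = ?b" .
  then have H: "h absolutely_integrable_on UNIV" "integral UNIV h = ?b"
    unfolding img by (rule conjunct1, rule conjunct2)
  show ?I
    using H(1) unfolding h_def[abs_def] set_integrable_def by simp
  have "(LINT t:UNIV|lebesgue. h t) = ?b"
    using set_lebesgue_integral_eq_integral(2)[OF H(1)] H(2) by (rule trans)
  then show ?E
    unfolding h_def[abs_def] set_lebesgue_integral_def by simp
qed

text \<open>Rotation by minus the argument makes the coefficient real and nonnegative, so its
  modulus is the integral of \<open>g\<close> against the real part of the rotated kernel. The
  rotation angle is unknown, hence a bound over all phases \<beta>.\<close>

lemma cmod_cauchy_coeff_le:
  assumes g: "essbound g M" and z: "Im z > 0" and B: "\<And>\<beta>. abs_cos_moment \<beta> p \<le> B"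
  shows "cmod (cauchy_coeff g z (p + 1)) \<le> M * B / Im z ^ (p + 1)"
proof -
  define C where "C = cauchy_coeff g z (p + 1)"
  define \<alpha> where "\<alpha> = - Arg C"
  let ?h = "\<lambda>t. \<bar>Re (cis \<alpha> / (of_real t - z) ^ (p + 2))\<bar>"
  let ?k = "\<lambda>t. of_real (g t) * (1 / (of_real t - z) ^ (p + 2))"
  have I: "integrable lebesgue (\<lambda>t. cis \<alpha> * ?k t)"
    by (intro integrable_mult_right essbound_kernel_power(1)[OF g z])
  have "cis \<alpha> * C = of_real (cmod C)"
  proof -
    have "C = of_real (cmod C) * cis (Arg C)" using rcis_cmod_Arg[of C] by (simp add: rcis_def)
    then have "cis \<alpha> * C = cis \<alpha> * cis (Arg C) * of_real (cmod C)" by (metis mult.commute mult.assoc)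
    then show ?thesis by (simp add: \<alpha>_def cis_mult)
  qed
  then have "cmod C = Re (cis \<alpha> * C)" by simp
  also have "\<dots> = Re (LINT t|lebesgue. cis \<alpha> * ?k t)"
    unfolding C_def cauchy_coeff_def by (simp only: integral_mult_right_zero one_add_one add.assoc)
  also have "\<dots> = (LINT t|lebesgue. Re (cis \<alpha> * ?k t))"
    by (rule integral_Re[OF I, symmetric])
  also have "\<dots> \<le> (LINT t|lebesgue. M * ?h t)"
  proof (rule integral_mono_AE)
    show "integrable lebesgue (\<lambda>t. Re (cis \<alpha> * ?k t))" by (rule integrable_Re[OF I])
    show "integrable lebesgue (\<lambda>t. M * ?h t)"
      by (rule integrable_mult_right[OF abs_Re_kernel_integral(1)[OF z]])
    have "AE t in lebesgue. \<bar>g t\<bar> \<le> M" using g by (simp add: essbound_def)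
    then show "AE t in lebesgue. Re (cis \<alpha> * ?k t) \<le> M * ?h t"
    proof eventually_elim
      case (elim t)
      have "cis \<alpha> * ?k t = of_real (g t) * (cis \<alpha> / (of_real t - z) ^ (p + 2))" by simp
      then have "Re (cis \<alpha> * ?k t) = g t * Re (cis \<alpha> / (of_real t - z) ^ (p + 2))"
        by (simp only: times_complex.sel Re_complex_of_real Im_complex_of_real mult_zero_left diff_zero)
      also have "\<dots> \<le> \<bar>g t\<bar> * ?h t" by (metis abs_ge_self abs_mult)
      also have "\<dots> \<le> M * ?h t" using elim by (intro mult_right_mono) auto
      finally show ?case .
    qed
  qed
  also have "\<dots> = M * (abs_cos_moment (\<alpha> + real (p + 2) * (pi / 2)) p / Im z ^ (p + 1))"
    by (simp only: integral_mult_right_zero abs_Re_kernel_integral(2)[OF z])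
  also have "\<dots> \<le> M * (B / Im z ^ (p + 1))"
    using z by (intro mult_left_mono divide_right_mono B essbound_nonneg[OF g]) auto
  finally show ?thesis by (simp add: C_def)
qed

section \<open>Passage from essential suprema to the sharp constant\<close>

lemma Linf_essbound:
  assumes "g \<in> Linf"
  shows "essbound g (real_of_ereal (Linf_norm g))"
proof -
  have AE: "AE t in lebesgue. ereal \<bar>g t\<bar> \<le> Linf_norm g"
    unfolding Linf_norm_def by (rule esssup_AE)
  \<comment> \<open>\<open>Linf\<close> excludes only the value +infinity. One point satisfying the
    bound excludes -infinity too, so \<open>real_of_ereal\<close> does not fall back to its default
    0.\<close>
  obtain t where "ereal \<bar>g t\<bar> \<le> Linf_norm g" using AE_lebesgue_imp_ex[OF AE] by blast
  then have "\<bar>Linf_norm g\<bar> \<noteq> \<infinity>"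
    using assms unfolding Linf_def by (cases "Linf_norm g") auto
  then have "Linf_norm g = ereal (real_of_ereal (Linf_norm g))" by (simp add: ereal_real')
  with AE have "AE t in lebesgue. \<bar>g t\<bar> \<le> real_of_ereal (Linf_norm g)"
    by (metis (no_types, lifting) ereal_less_eq(3) eventually_mono)
  then show ?thesis using assms by (simp add: essbound_def Linf_def)
qed

lemma valid_const_upper:
  assumes B: "\<And>\<beta>. abs_cos_moment \<beta> p \<le> B"
  shows "valid_const (p + 1) (fact (p + 1) / pi * B)"
  unfolding valid_const_def
proof (intro allI impI)
  fix f g z
  assume f: "f analytic_on upper_half_plane" and h: "hinf_with_boundary (\<lambda>w. Re (f w)) g"
    and "z \<in> upper_half_plane"
  then have z: "Im z > 0" by (simp add: upper_half_plane_def)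
  have g: "essbound g (real_of_ereal (Linf_norm g))" (is "essbound g ?M")
    using h by (intro Linf_essbound) (simp add: hinf_with_boundary_def)
  have "(deriv ^^ (p + 1)) f z = fact (p + 1) / (of_real pi * \<i>) * cauchy_coeff g z (p + 1)"
    using h by (intro higher_deriv_of_poisson[OF f g _ z]) (auto simp: hinf_with_boundary_def)
  then have "cmod ((deriv ^^ (p + 1)) f z) = fact (p + 1) / pi * cmod (cauchy_coeff g z (p + 1))"
    by (simp only: norm_mult norm_divide norm_fact) simp
  also have "\<dots> \<le> fact (p + 1) / pi * (?M * B / Im z ^ (p + 1))"
    by (intro mult_left_mono cmod_cauchy_coeff_le[OF g z B]) simp
  finally show "cmod ((deriv ^^ (p + 1)) f z) \<le> fact (p + 1) / pi * B / Im z ^ (p + 1) * ?M"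
    by (simp add: mult_ac)
qed

text \<open>The extremal boundary function at \<open>\<i>\<close> is the sign of the real part of the kernel.\<close>
lemma valid_const_lower:
  assumes K: "valid_const (p + 1) K"
  shows "fact (p + 1) / pi * abs_cos_moment (real (p + 2) * (pi / 2)) p \<le> K"
proof -
  let ?k = "\<lambda>t. 1 / (of_real t - \<i>) ^ (p + 2)"
  define g where "g t = (if Re (?k t) \<ge> 0 then 1 else - 1 :: real)" for t
  have gm: "g \<in> borel_measurable lebesgue" unfolding g_def by measurable
  have abs_g: "\<bar>g t\<bar> = 1" for t by (simp add: g_def)
  have norm_g: "Linf_norm g = 1"
    unfolding Linf_norm_def abs_g by (subst esssup_const) (simp_all add: one_ereal_def)
  have g: "essbound g 1" using gm abs_g by (simp add: essbound_def)
  define f where "f w = cauchy_transform g \<i> w / (of_real pi * \<i>) + of_real (poisson_integral g \<i>)" for w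
  have f: "f analytic_on upper_half_plane"
    unfolding f_def by (intro analytic_intros cauchy_transform_analytic[OF g]) auto
  have Re_f: "Re (f w) = poisson_integral g w" if "w \<in> upper_half_plane" for w
    unfolding f_def using that by (intro Re_cauchy_transform[OF g]) (auto simp: upper_half_plane_def)
  have "hinf_with_boundary (\<lambda>w. Re (f w)) g"
    using gm norm_g Re_f by (simp add: hinf_with_boundary_def Linf_def)
  then have "cmod ((deriv ^^ (p + 1)) f \<i>) \<le> K / Im \<i> ^ (p + 1) * real_of_ereal (Linf_norm g)"
    by (intro K[unfolded valid_const_def, rule_format, OF f]) (simp_all add: upper_half_plane_def)
  then have le: "cmod ((deriv ^^ (p + 1)) f \<i>) \<le> K" by (simp add: norm_g)
  have I: "integrable lebesgue (\<lambda>t. of_real (g t) * ?k t)"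
    by (rule essbound_kernel_power(1)[OF g]) simp
  \<comment> \<open>The angle \<alpha> = 0 yields this one phase. Its moment may lie below the
    maximum over phases, but by the uniform estimate only by a term of lower order.\<close>
  have "abs_cos_moment (real (p + 2) * (pi / 2)) p = (LINT t|lebesgue. \<bar>Re (?k t)\<bar>)"
    using abs_Re_kernel_integral(2)[of \<i> 0 p] by simp
  also have "\<dots> = (LINT t|lebesgue. Re (of_real (g t) * ?k t))"
  proof (rule Bochner_Integration.integral_cong[OF refl])
    fix t
    have "Re (of_real (g t) * ?k t) = g t * Re (?k t)"
      by (simp only: times_complex.sel Re_complex_of_real Im_complex_of_real mult_zero_left diff_zero)
    then show "\<bar>Re (?k t)\<bar> = Re (of_real (g t) * ?k t)" by (simp only: g_def) auto
  qed
  also have "\<dots> = Re (cauchy_coeff g \<i> (p + 1))"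
    unfolding cauchy_coeff_def using integral_Re[OF I] by simp
  also have "\<dots> \<le> cmod (cauchy_coeff g \<i> (p + 1))" by (rule complex_Re_le_cmod)
  finally have "fact (p + 1) / pi * abs_cos_moment (real (p + 2) * (pi / 2)) p
      \<le> fact (p + 1) / pi * cmod (cauchy_coeff g \<i> (p + 1))"
    by (intro mult_left_mono) auto
  also have "\<dots> = cmod ((deriv ^^ (p + 1)) f \<i>)"
    by (subst higher_deriv_of_poisson[OF f g Re_f])
      (simp_all only: norm_mult norm_divide norm_fact, simp_all)
  finally show ?thesis using le by linarith
qed

text \<open>\<open>LEAST\<close> over the reals is informative only if the minimum is attained. The
  valid constants form a closed set, being cut out by non-strict inequalities continuous in K;
  \<open>U\<close> shows that it is nonempty and \<open>L\<close> bounds it below, so it contains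
  its infimum.\<close>

lemma sharp_const_bounds:
  assumes U: "valid_const n U" and L: "\<And>K. valid_const n K \<Longrightarrow> L \<le> K"
  shows "L \<le> sharp_const n" and "sharp_const n \<le> U"
proof -
  let ?V = "{K. valid_const n K}"
  have "continuous_on UNIV (\<lambda>K::real. K / c * M)" for c M
    unfolding divide_inverse by (intro continuous_on_mult continuous_on_id continuous_on_const)
  then have "closed ?V"
    unfolding valid_const_def
    by (intro closed_Collect_all closed_Collect_imp open_Collect_const closed_Collect_le continuous_on_const)
  moreover have ne: "?V \<noteq> {}" using U by auto
  moreover have bdd: "bdd_below ?V" by (rule bdd_belowI[of _ L]) (simp add: L)
  ultimately have "Inf ?V \<in> ?V" by (intro closed_contains_Inf)
  then have "sharp_const n = Inf ?V"
    unfolding sharp_const_def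
    by (intro Least_equality) (auto intro: cInf_lower[OF _ bdd])
  then show "L \<le> sharp_const n" "sharp_const n \<le> U"
    using \<open>Inf ?V \<in> ?V\<close> L U cInf_lower[OF _ bdd, of U] by auto
qed

lemma sharp_const_estimate:
  obtains B where "B \<ge> 0"
    "\<And>p. \<bar>sharp_const (p + 3) - fact (p + 3) / pi * (2 / pi * cos_moment (p + 2))\<bar>
       \<le> fact (p + 3) / pi * (B / real (p + 4) * cos_moment (p + 2))"
proof -
  obtain B where B0: "B \<ge> 0" and
    B: "\<And>\<beta> p. \<bar>abs_cos_moment \<beta> (p + 2) - 2 / pi * cos_moment (p + 2)\<bar> \<le> B / real (p + 4) * cos_moment (p + 2)"
    by (rule abs_cos_moment_estimate) (rule that)
  have "\<bar>sharp_const (p + 3) - fact (p + 3) / pi * (2 / pi * cos_moment (p + 2))\<bar>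
       \<le> fact (p + 3) / pi * (B / real (p + 4) * cos_moment (p + 2))" for p
  proof -
    define J e c :: real where "J = 2 / pi * cos_moment (p + 2)" and "e = B / real (p + 4) * cos_moment (p + 2)"
      and "c = fact (p + 3) / pi"
    have c: "c \<ge> 0" by (simp add: c_def)
    have p: "p + 2 + 1 = p + 3" by simp
    have J: "J - e \<le> abs_cos_moment \<beta> (p + 2)" "abs_cos_moment \<beta> (p + 2) \<le> J + e" for \<beta>
      using B[of \<beta> p] unfolding J_def e_def abs_le_iff by linarith+
    have U: "valid_const (p + 3) (c * (J + e))"
      using valid_const_upper[OF J(2)] unfolding p c_def .
    have L: "c * (J - e) \<le> K" if "valid_const (p + 3) K" for K
      using valid_const_lower[of "p + 2" K] that mult_left_mono[OF J(1) c]
      unfolding p c_def by (meson order_trans)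
    have "c * (J - e) \<le> sharp_const (p + 3)" "sharp_const (p + 3) \<le> c * (J + e)"
      using sharp_const_bounds[OF U L] by auto
    then have "\<bar>sharp_const (p + 3) - c * J\<bar> \<le> c * e"
      by (simp add: abs_le_iff algebra_simps)
    then show ?thesis unfolding c_def J_def e_def .
  qed
  then show ?thesis using that B0 by metis
qed

subsection \<open>Double factorials and Wallis products\<close>

lemma fact_eq_double_fact: "fact (Suc n) = double_fact (Suc n) * double_fact n"
proof (induction n)
  case (Suc n)
  have "fact (Suc (Suc n)) = Suc (Suc n) * (fact (Suc n) :: nat)" by (rule fact_Suc[where 'a=nat, simplified of_nat_id])
  then show ?case using Suc.IH by (simp only: double_fact.simps mult_ac)
qed simp

lemma double_fact_pos: "double_fact n > 0"
  by (induction n rule: double_fact.induct) auto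

lemma double_fact_add_2: "real (double_fact (n + 2)) = real (n + 2) * real (double_fact n)"
  unfolding of_nat_mult[symmetric] add_2_eq_Suc' double_fact.simps ..

lemma cos_moment_odd:
  "cos_moment (2 * m + 1) * real (double_fact (2 * m + 1)) = 2 * real (double_fact (2 * m))"
proof (induction m)
  case 0
  show ?case using cos_moment_1 by simp
next
  case (Suc m)
  have "cos_moment (2 * m + 1 + 2) * real (double_fact (2 * m + 1 + 2)) =
      (real (2 * m + 1 + 2) * cos_moment (2 * m + 1 + 2)) * real (double_fact (2 * m + 1))"
    unfolding double_fact_add_2 by (simp only: mult_ac)
  also have "\<dots> = real (2 * m + 2) * (cos_moment (2 * m + 1) * real (double_fact (2 * m + 1)))"
    unfolding cos_moment_rec by simp
  also have "\<dots> = 2 * real (double_fact (2 * m + 2))"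
    unfolding Suc.IH double_fact_add_2 by (simp only: mult_ac)
  finally show ?case by (simp only: mult_Suc_right add_ac)
qed

text \<open>In the factorization 4 k^2 - 1 = (2 k - 1)(2 k + 1) every odd number from 3 to 2 m - 1
  occurs twice over the product but 2 m + 1 only once, which explains the extra factor.\<close>

lemma wallis_double_fact:
  "(\<Prod>k=1..m. (4 * real k ^ 2) / (4 * real k ^ 2 - 1))
     = (real (double_fact (2 * m)) / real (double_fact (2 * m + 1)))\<^sup>2 * (2 * real m + 1)"
proof (induction m)
  case (Suc m)
  define x D E where "x = real m" and "D = real (double_fact (2 * m + 1))" and "E = real (double_fact (2 * m))"
  have x: "x \<ge> 0" and D: "D \<noteq> 0"
    using double_fact_pos[of "2 * m + 1"] by (simp_all add: x_def D_def)
  have "(E / D)\<^sup>2 * (2 * x + 1) * (4 * (x + 1)\<^sup>2 / (4 * (x + 1)\<^sup>2 - 1)) =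
    ((2 * x + 2) * E / ((2 * x + 3) * D))\<^sup>2 * (2 * (x + 1) + 1)"
  proof -
    have "4 * (x + 1)\<^sup>2 - 1 = (2 * x + 1) * (2 * x + 3)"
      by (simp add: power2_eq_square algebra_simps)
    moreover have "2 * x + 1 \<noteq> 0" "2 * x + 3 \<noteq> 0" using x by auto
    ultimately show ?thesis using D
      by (simp add: divide_simps power2_eq_square)
        (rule disjI2, simp add: algebra_simps)
  qed
  moreover have "real (double_fact (2 * Suc m)) = (2 * x + 2) * E"
    "real (double_fact (2 * Suc m + 1)) = (2 * x + 3) * D"
    using double_fact_add_2[of "2 * m"] double_fact_add_2[of "2 * m + 1"]
    by (simp_all add: x_def D_def E_def)
  moreover have "real (Suc m) = x + 1" by (simp add: x_def)
  ultimately show ?case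
    using Suc.IH by (simp only: prod.cl_ivl_Suc D_def E_def x_def) simp
qed simp

text \<open>The partial products increase to pi/2, while their multiples by 1 + 1 / (2 m) decrease
  to it. The two monotone sequences enclose the limit with an explicit error.\<close>

lemma wallis_bounds:
  fixes m :: nat
  defines "a \<equiv> \<lambda>m. \<Prod>k=1..m. (4 * real k ^ 2) / (4 * real k ^ 2 - 1)"
  shows "a m \<le> pi / 2" and "m \<ge> 1 \<Longrightarrow> pi / 2 \<le> a m * (1 + 1 / (2 * real m))"
proof -
  have lim: "a \<longlonglongrightarrow> pi / 2" unfolding a_def by (rule wallis)
  have Suc: "a (Suc m) = a m * ((4 * real (Suc m) ^ 2) / (4 * real (Suc m) ^ 2 - 1))" for m
    by (simp add: a_def)
  have pos: "4 * real (Suc m) ^ 2 - 1 > 0" for m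
    using one_le_power[of "real (Suc m)" 2] by linarith
  have a_pos: "a m > 0" for m
  proof (induction m)
    case (Suc m)
    then show ?case unfolding \<open>\<And>m. a (Suc m) = _ m\<close> using pos[of m] by (intro mult_pos_pos divide_pos_pos) auto
  qed (simp add: a_def)
  have "incseq a"
  proof (rule incseq_SucI)
    fix m
    have "1 \<le> (4 * real (Suc m) ^ 2) / (4 * real (Suc m) ^ 2 - 1)" using pos[of m] by (simp add: le_divide_eq)
    from mult_left_mono[OF this, of "a m"] show "a m \<le> a (Suc m)" using a_pos[of m] unfolding Suc by simp
  qed
  then show "a m \<le> pi / 2" using lim by (rule incseq_le)
  \<comment> \<open>The index is shifted because at m = 0 the quotient 1 / (2 m) would be 0 by
    convention and monotonicity would fail.\<close>
  define b where "b m = a (Suc m) * (1 + 1 / (2 * real (Suc m)))" for m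
  have "decseq b"
  proof (rule decseq_SucI)
    fix m
    define x where "x = real (Suc (Suc m))"
    have x: "x \<ge> 2" "real (Suc m) = x - 1" by (auto simp: x_def)
    have p: "4 * x ^ 2 - 1 > 0" using pos[of "Suc m"] by (simp add: x_def)
    have "(4 * x ^ 2) / (4 * x ^ 2 - 1) * (1 + 1 / (2 * x)) = 2 * x / (2 * x - 1)"
      using x p by (simp add: divide_simps) (simp add: algebra_simps power2_eq_square power3_eq_cube)
    also have "\<dots> \<le> 1 + 1 / (2 * (x - 1))"
      using x by (simp add: field_simps)
    finally have "a (Suc m) * ((4 * x ^ 2) / (4 * x ^ 2 - 1) * (1 + 1 / (2 * x))) \<le> a (Suc m) * (1 + 1 / (2 * (x - 1)))"
      using a_pos[of "Suc m"] by (intro mult_left_mono) auto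
    then show "b (Suc m) \<le> b m" unfolding b_def Suc[of "Suc m"] x(2) x_def[symmetric] by (simp add: mult.assoc)
  qed
  moreover have "b \<longlonglongrightarrow> pi / 2"
  proof -
    have "(\<lambda>m. 1 / (2 * real (Suc m))) \<longlonglongrightarrow> 0" by real_asymp
    from tendsto_mult[OF LIMSEQ_Suc[OF lim] tendsto_add[OF tendsto_const[of 1] this]]
    have "b \<longlonglongrightarrow> pi / 2 * (1 + 0)" unfolding b_def .
    then show ?thesis by simp
  qed
  ultimately have "pi / 2 \<le> b n" for n by (rule decseq_ge)
  from this[of "m - 1"] show "pi / 2 \<le> a m * (1 + 1 / (2 * real m))" if "m \<ge> 1"
    using that by (simp add: b_def)
qed

text \<open>Splitting (2 k + 2)! into two double factorials cancels the odd one against the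
  denominator of the moment; (2 k)!! = (2 k + 2)!! / (2 k + 2) then yields the square.\<close>

lemma fact_cos_moment:
  "fact (2 * k + 2) * cos_moment (2 * k + 1) = (real (double_fact (2 * k + 2)))\<^sup>2 / real (k + 1)"
proof -
  define E I where "E = real (double_fact (2 * k))" and "I = cos_moment (2 * k + 1)"
  have "fact (2 * k + 2) = double_fact (2 * k + 2) * double_fact (2 * k + 1)"
    using fact_eq_double_fact[of "2 * k + 1"] by simp
  then have "fact (2 * k + 2) = real (double_fact (2 * k + 2)) * real (double_fact (2 * k + 1))"
    by (metis of_nat_fact of_nat_mult)
  then have "fact (2 * k + 2) * I = real (double_fact (2 * k + 2)) * (I * real (double_fact (2 * k + 1)))"
    by (simp only: mult_ac)
  also have "\<dots> = real (double_fact (2 * k + 2)) * (2 * E)"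
    using cos_moment_odd[of k] unfolding E_def I_def by (simp only:)
  also have "\<dots> = (real (double_fact (2 * k + 2)))\<^sup>2 / real (k + 1)"
    unfolding double_fact_add_2 E_def[symmetric] by (simp add: field_simps power2_eq_square)
  finally show ?thesis unfolding I_def .
qed

text \<open>\<open>R\<close> is half the product in \<open>fact_cos_moment\<close>. The Wallis
  bounds at k + 1, solved for the even double factorial, compare it with the square of the odd
  one.\<close>

lemma double_fact_even_bounds:
  fixes k :: nat
  defines "R \<equiv> (real (double_fact (2 * k + 2)))\<^sup>2 / (2 * real (k + 1))"
    and "D \<equiv> real (double_fact (2 * k + 1))"
  shows "pi / 2 * D\<^sup>2 \<le> R" and "R \<le> pi / 2 * D\<^sup>2 * (1 + 1 / (2 * real (k + 1)))"
proof -
  define x E where "x = real (k + 1)" and "E = real (double_fact (2 * k + 2))"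
  have x: "x > 0" by (simp add: x_def)
  have D: "D > 0" using double_fact_pos by (simp add: D_def)
  have "real (double_fact (2 * (k + 1) + 1)) = (2 * x + 1) * D"
    using double_fact_add_2[of "2 * k + 1"] by (simp add: x_def D_def)
  then have a: "(\<Prod>j=1..k+1. (4 * real j ^ 2) / (4 * real j ^ 2 - 1)) = (E / ((2 * x + 1) * D))\<^sup>2 * (2 * x + 1)"
    using wallis_double_fact[of "k + 1"] by (simp add: x_def E_def)
  have R: "R = E\<^sup>2 / (2 * x)" by (simp add: R_def E_def x_def)
  have 1: "(E / ((2 * x + 1) * D))\<^sup>2 * (2 * x + 1) = E\<^sup>2 / ((2 * x + 1) * D\<^sup>2)"
    using x D by (simp add: power2_eq_square divide_simps)
  have "E\<^sup>2 / ((2 * x + 1) * D\<^sup>2) \<le> pi / 2"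
    using wallis_bounds(1)[of "k + 1"] unfolding a 1 .
  then have "E\<^sup>2 \<le> pi / 2 * ((2 * x + 1) * D\<^sup>2)"
    using x D by (simp add: pos_divide_le_eq)
  then have "E\<^sup>2 / (2 * x) \<le> pi / 2 * ((2 * x + 1) * D\<^sup>2) / (2 * x)"
    using x by (intro divide_right_mono) auto
  also have "\<dots> = pi / 2 * D\<^sup>2 * (1 + 1 / (2 * x))"
    using x by (simp add: field_simps)
  finally show "R \<le> pi / 2 * D\<^sup>2 * (1 + 1 / (2 * real (k + 1)))" unfolding R x_def .
  have "pi / 2 \<le> E\<^sup>2 / ((2 * x + 1) * D\<^sup>2) * (1 + 1 / (2 * x))"
    using wallis_bounds(2)[of "k + 1"] unfolding a 1 by (simp add: x_def)
  also have "\<dots> = E\<^sup>2 / (2 * x) / D\<^sup>2"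
    using x D by (simp add: divide_simps)
  finally show "pi / 2 * D\<^sup>2 \<le> R" using D unfolding R by (simp only: pos_le_divide_eq zero_less_power)
qed

section \<open>Asymptotics of the sharp constant of even order\<close>

theorem mainTheorem5:
  shows "(\<lambda>m::nat. sharp_const (2 * m) - 2 / pi * (real (double_fact (2 * m - 1)))\<^sup>2)
           \<in> O(\<lambda>m. (real (double_fact (2 * m - 1)))\<^sup>2 / (2 * real m - 1))"
proof -
  obtain B where B0: "B \<ge> 0" and
    B: "\<And>p. \<bar>sharp_const (p + 3) - fact (p + 3) / pi * (2 / pi * cos_moment (p + 2))\<bar>
       \<le> fact (p + 3) / pi * (B / real (p + 4) * cos_moment (p + 2))"
    by (rule sharp_const_estimate) (rule that)
  show ?thesis
  \<comment> \<open>The summand 2 / pi pays for the Wallis error in the main term, and 2 B for the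
    oscillation error.\<close>
  proof (rule bigoI[where c = "2 / pi + 2 * B"])
    show "\<forall>\<^sub>F m in at_top. norm (sharp_const (2 * m) - 2 / pi * (real (double_fact (2 * m - 1)))\<^sup>2)
        \<le> (2 / pi + 2 * B) * norm ((real (double_fact (2 * m - 1)))\<^sup>2 / (2 * real m - 1))"
      \<comment> \<open>For m >= 2 the order 2 m has the form p + 3. At m = 1 the weight would be
        the cosine itself, whose derivative does not vanish at the endpoints.\<close>
      using eventually_ge_at_top[of 2]
    proof eventually_elim
      case (elim m)
      then obtain j where "m = 2 + j" using le_Suc_ex by blast
      then have m: "m = j + 2" by simp
      have j: "2 * (j + 1) + 2 = 2 * m" "2 * (j + 1) + 1 = 2 * m - 1" "j + 1 + 1 = m"
        by (simp_all add: m)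
      define D R x where "D = real (double_fact (2 * m - 1))" and
        "R = (real (double_fact (2 * m)))\<^sup>2 / (2 * real m)" and "x = real m"
      have x: "x \<ge> 2" by (simp add: x_def m)
      have "fact (2 * m) * cos_moment (2 * m - 1) = 2 * R"
        using fact_cos_moment[of "j + 1"] unfolding j R_def by simp
      then have f: "fact (2 * m) / pi * (c * cos_moment (2 * m - 1)) = 2 * R / pi * c" for c
        by (simp add: field_simps)
      have "2 * m = (2 * j + 1) + 3" "2 * m - 1 = (2 * j + 1) + 2" "2 * m + 1 = (2 * j + 1) + 4"
        by (simp_all add: m)
      then have "\<bar>sharp_const (2 * m) - 2 * R / pi * (2 / pi)\<bar> \<le> 2 * R / pi * (B / real (2 * m + 1))"
        using B[of "2 * j + 1"] unfolding f[symmetric] by (simp only:)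
      then have 1: "\<bar>sharp_const (2 * m) - 4 / pi\<^sup>2 * R\<bar> \<le> 2 * B / pi / (2 * x + 1) * R"
        by (simp add: x_def power2_eq_square mult_ac add.commute)
      have R: "pi / 2 * D\<^sup>2 \<le> R" "R \<le> pi / 2 * D\<^sup>2 * (1 + 1 / (2 * x))"
        using double_fact_even_bounds[of "j + 1"] unfolding j R_def D_def x_def .
      \<comment> \<open>In the oscillation error the crude factor 2 suffices; the main term below
        uses the sharp two-sided bound.\<close>
      have "1 + 1 / (2 * x) \<le> 2" using x by (simp add: divide_simps)
      then have "pi / 2 * D\<^sup>2 * (1 + 1 / (2 * x)) \<le> pi / 2 * D\<^sup>2 * 2"
        by (intro mult_left_mono) auto
      from order_trans[OF R(2) this] have "R \<le> pi * D\<^sup>2" by simp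
      then have "2 * B / pi / (2 * x + 1) * R \<le> 2 * B / pi / (2 * x + 1) * (pi * D\<^sup>2)"
        using B0 x by (intro mult_left_mono) auto
      also have "\<dots> = 2 * B * D\<^sup>2 / (2 * x + 1)" by simp
      also have "\<dots> \<le> 2 * B * D\<^sup>2 / (2 * x - 1)"
        using B0 x by (intro divide_left_mono) auto
      finally have 2: "2 * B / pi / (2 * x + 1) * R \<le> 2 * B * D\<^sup>2 / (2 * x - 1)" .
      have "4 / pi\<^sup>2 * (pi / 2 * D\<^sup>2) \<le> 4 / pi\<^sup>2 * R"
        "4 / pi\<^sup>2 * R \<le> 4 / pi\<^sup>2 * (pi / 2 * D\<^sup>2 * (1 + 1 / (2 * x)))"
        using R by (intro mult_left_mono; simp)+
      then have "2 / pi * D\<^sup>2 \<le> 4 / pi\<^sup>2 * R" "4 / pi\<^sup>2 * R \<le> 2 / pi * D\<^sup>2 + 2 / pi * D\<^sup>2 / (2 * x)"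
        by (simp_all add: power2_eq_square distrib_left)
      moreover have "2 / pi * D\<^sup>2 / (2 * x) \<le> 2 / pi * D\<^sup>2 / (2 * x - 1)"
        using x by (intro divide_left_mono) auto
      ultimately have "\<bar>sharp_const (2 * m) - 2 / pi * D\<^sup>2\<bar>
          \<le> 2 / pi * D\<^sup>2 / (2 * x - 1) + 2 * B * D\<^sup>2 / (2 * x - 1)"
        using 1 2 by linarith
      also have "\<dots> = (2 / pi + 2 * B) * (D\<^sup>2 / (2 * x - 1))"
        by (simp only: distrib_right times_divide_eq_right add_divide_distrib)
      also have "D\<^sup>2 / (2 * x - 1) = norm (D\<^sup>2 / (2 * x - 1))" using x by simp
      finally show ?case by (simp only: real_norm_def D_def x_def)
    qed
  qed
qed

end
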